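(* Let $X$ be a weighted graph on $n$ vertices and let $M\in\{A(X),L(X),Q(X)\}$. If local $\epsilon$-uniform mixing occurs at a vertex $u$ of $X$ relative to $M$, then each eigenvector $\mathbf{v}=[v_1,\ldots,v_n]^T$ of $M$ satisfies $$\sqrt{n}\,|v_u|\le\sum_{j}|v_j|.$$ In particular, if $\epsilon$-uniform mixing occurs in $X$ relative to $M$, then this inequality holds for each vertex $u$ of $X$ (and each eigenvector of $M$).
   Context: Graphs are finite, simple, undirected and connected, with positive real edge weights. $A(X)$ is the weighted adjacency matrix, $D(X)$ is the diagonal matrix of vertex degrees (degree = sum of weights of incident edges), $L(X)=D(X)-A(X)$, $Q(X)=D(X)+A(X)$. Put $U(t)=e^{\mathrm{i}tM}$. $\mathbf{e}_u$ is the characteristic vector of $u$, $\mathbf{1}$ the all-ones vector, $\circ$ the entrywise product. Local $\epsilon$-uniform mixing occurs at $u$ relative to $M$ if for each $\epsilon>0$ there is a time $\tau\in\mathbb{R}$ such that $\big\|(U(\tau)\mathbf{e}_u)\circ(\overline{U(\tau)}\mathbf{e}_u)-\tfrac1n\mathbf{1}\big\|<\epsilon$. $\epsilon$-uniform mixing occurs in $X$ if for each $\epsilon>0$ there is a $\tau$ for which this inequality holds simultaneously for all vertices $u$. *)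

theory Defs
  imports "HOL-Analysis.Analysis"
begin

section \<open>Weighted graphs\<close>

text \<open>The vertex set is the whole (finite) vertex type; values of \<open>weight\<close> outside
  \<open>edges\<close> are irrelevant.\<close>

record 'v wgraph =
  edges :: "'v set set"
  weight :: "'v set \<Rightarrow> real"

definition weighted_graph :: "'v::finite wgraph \<Rightarrow> bool" where
  "weighted_graph X \<longleftrightarrow>
     edges X \<subseteq> {{u, v} |u v. u \<noteq> v} \<and>
     (\<forall>e \<in> edges X. weight X e > 0) \<and>
     (\<forall>u v. (u, v) \<in> {(x, y). {x, y} \<in> edges X}\<^sup>*)"

definition adjacency_matrix :: "'v::finite wgraph \<Rightarrow> real^'v^'v" where
  "adjacency_matrix X = (\<chi> u v. if {u, v} \<in> edges X then weight X {u, v} else 0)"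

definition degree :: "'v::finite wgraph \<Rightarrow> 'v \<Rightarrow> real" where
  "degree X u = (\<Sum>e \<in> {e \<in> edges X. u \<in> e}. weight X e)"

definition degree_matrix :: "'v::finite wgraph \<Rightarrow> real^'v^'v" where
  "degree_matrix X = (\<chi> u v. if u = v then degree X u else 0)"

definition laplacian :: "'v::finite wgraph \<Rightarrow> real^'v^'v" where
  "laplacian X = degree_matrix X - adjacency_matrix X"

definition signless_laplacian :: "'v::finite wgraph \<Rightarrow> real^'v^'v" where
  "signless_laplacian X = degree_matrix X + adjacency_matrix X"

section \<open>The transition matrix\<close>

text \<open>The class operations \<open>*\<close> and \<open>^\<close> act entrywise on \<open>vec\<close>, so matrix powers are
  defined here through \<open>**\<close>.\<close>

primrec matrix_power :: "'a::semiring_1^'n^'n \<Rightarrow> nat \<Rightarrow> 'a^'n^'n" where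
  "matrix_power A 0 = mat 1"
| "matrix_power A (Suc k) = A ** matrix_power A k"

definition matrix_exp :: "complex^'n^'n \<Rightarrow> complex^'n^'n" where
  "matrix_exp A = (\<Sum>k. (1 / fact k) *\<^sub>R matrix_power A k)"

lemma summable_matrix_exp:
  fixes A :: "complex^'n^'n"
  shows "summable (\<lambda>k. (1 / fact k) *\<^sub>R matrix_power A k)"
proof -
  define c where "c = (\<Sum>i\<in>UNIV. \<Sum>j\<in>UNIV. norm (A $ i $ j))"
  define N where "N = real CARD('n)"
  have c: "norm (A $ i $ j) \<le> c" for i j
  proof -
    have "norm (A $ i $ j) \<le> (\<Sum>j\<in>UNIV. norm (A $ i $ j))"
      by (rule member_le_sum) auto
    also have "\<dots> \<le> c"
      unfolding c_def
      by (rule member_le_sum[where f = "\<lambda>i. \<Sum>j\<in>UNIV. norm (A $ i $ j)"]) (auto intro: sum_nonneg)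
    finally show ?thesis .
  qed
  have c0: "c \<ge> 0"
    unfolding c_def by (intro sum_nonneg) auto
  have entry: "norm (matrix_power A k $ i $ j) \<le> (N * c) ^ k" for k i j
  proof (induction k arbitrary: i j)
    case 0
    show ?case by (simp add: mat_def)
  next
    case (Suc k)
    have "norm (matrix_power A (Suc k) $ i $ j)
        \<le> (\<Sum>l\<in>UNIV. norm (A $ i $ l * matrix_power A k $ l $ j))"
      by (simp add: matrix_matrix_mult_def norm_sum)
    also have "\<dots> \<le> (\<Sum>l\<in>(UNIV::'n set). c * (N * c) ^ k)"
      by (intro sum_mono) (auto simp: norm_mult intro!: mult_mono c Suc c0)
    also have "\<dots> = (N * c) ^ Suc k"
      by (simp add: N_def algebra_simps)
    finally show ?case .
  qed
  have bound: "norm (matrix_power A k) \<le> N * N * (N * c) ^ k" for k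
  proof -
    have "norm (matrix_power A k) \<le> (\<Sum>i\<in>UNIV. norm (matrix_power A k $ i))"
      by (simp add: norm_vec_def L2_set_le_sum)
    also have "\<dots> \<le> (\<Sum>i\<in>(UNIV::'n set). \<Sum>j\<in>UNIV. norm (matrix_power A k $ i $ j))"
      by (intro sum_mono) (simp add: norm_vec_def L2_set_le_sum)
    also have "\<dots> \<le> (\<Sum>i\<in>(UNIV::'n set). \<Sum>j\<in>(UNIV::'n set). (N * c) ^ k)"
      by (intro sum_mono entry)
    also have "\<dots> = N * N * (N * c) ^ k"
      by (simp add: N_def)
    finally show ?thesis .
  qed
  have "summable (\<lambda>k. N * N * (inverse (fact k) * (N * c) ^ k))"
    by (intro summable_mult summable_exp)
  then show ?thesis
  proof (rule summable_comparison_test')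
    fix k :: nat
    assume "k \<ge> 0"
    have "norm ((1 / fact k) *\<^sub>R matrix_power A k) = norm (matrix_power A k) / fact k"
      by simp
    also have "\<dots> \<le> (N * N * (N * c) ^ k) / fact k"
      by (intro divide_right_mono bound) simp
    finally show "norm ((1 / fact k) *\<^sub>R matrix_power A k)
        \<le> N * N * (inverse (fact k) * (N * c) ^ k)"
      by (simp add: field_simps)
  qed
qed

definition transition_matrix :: "real^'n^'n \<Rightarrow> real \<Rightarrow> complex^'n^'n" where
  "transition_matrix M t = matrix_exp (map_matrix (\<lambda>m. \<i> * complex_of_real (t * m)) M)"

section \<open>Uniform mixing\<close>

text \<open>In \<open>mixing_error\<close>, \<open>*\<close> is the entrywise product of vectors, \<open>1\<close> the all-ones
  vector and \<open>norm\<close> the Euclidean norm.\<close>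

definition mixing_error :: "real^'n^'n \<Rightarrow> real \<Rightarrow> 'n \<Rightarrow> real" where
  "mixing_error M t u =
     norm ((transition_matrix M t *v axis u 1) *
           (map_matrix cnj (transition_matrix M t) *v axis u 1)
           - (1 / real CARD('n)) *\<^sub>R (1 :: complex^'n))"

definition local_epsilon_uniform_mixing :: "real^'n^'n \<Rightarrow> 'n \<Rightarrow> bool" where
  "local_epsilon_uniform_mixing M u \<longleftrightarrow> (\<forall>\<epsilon>>0. \<exists>\<tau>. mixing_error M \<tau> u < \<epsilon>)"

definition epsilon_uniform_mixing :: "real^'n^'n \<Rightarrow> bool" where
  "epsilon_uniform_mixing M \<longleftrightarrow> (\<forall>\<epsilon>>0. \<exists>\<tau>. \<forall>u. mixing_error M \<tau> u < \<epsilon>)"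

text \<open>Eigenvectors are allowed to be complex; a real eigenvector is the special case in which
  all entries of \<open>v\<close> are real.\<close>

definition eigenvector :: "real^'n^'n \<Rightarrow> complex^'n \<Rightarrow> bool" where
  "eigenvector M v \<longleftrightarrow>
     v \<noteq> 0 \<and> (\<exists>c :: complex. map_matrix complex_of_real M *v v = c *s v)"

end

theory Submission
  imports Defs
begin

text \<open>The matrix \<open>M\<close> is real symmetric, so \<open>U(t)\<close> is symmetric and an eigenvector \<open>v\<close> for \<open>c\<close>
  satisfies \<open>U(t) v = exp (i t c) v\<close> with \<open>c\<close> real. Hence
  \<open>|v_u| = |(U(t) v)_u| \<le> (\<Sum>j. |U(t)_ju| |v_j|)\<close>, and local mixing at \<open>u\<close> makes all
  \<open>|U(t)_ju|\<close> at most \<open>sqrt (1/n + \<epsilon>)\<close> at a suitable time. Let \<open>\<epsilon>\<close> tend to \<open>0\<close>.\<close>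

lemma transpose_add: "transpose (A + B) = transpose A + transpose (B :: 'a::plus^'n^'m)"
  by (simp add: transpose_def vec_eq_iff)

lemma transpose_diff: "transpose (A - B) = transpose A - transpose (B :: 'a::minus^'n^'m)"
  by (simp add: transpose_def vec_eq_iff)

lemma transpose_adjacency_matrix: "transpose (adjacency_matrix X) = adjacency_matrix X"
  by (simp add: transpose_def adjacency_matrix_def vec_eq_iff insert_commute)

lemma transpose_degree_matrix: "transpose (degree_matrix X) = degree_matrix X"
  by (simp add: transpose_def degree_matrix_def vec_eq_iff)

text \<open>Transposition reverses products, so transposing a power produces the recursion with the
  new factor on the right.\<close>

lemma matrix_power_Suc2: "matrix_power A (Suc k) = matrix_power A k ** A"
  by (induction k) (simp_all add: matrix_mul_assoc)

lemma transpose_matrix_power: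
  fixes A :: "'a::comm_semiring_1^'n^'n"
  shows "transpose (matrix_power A k) = matrix_power (transpose A) k"
proof (induction k)
  case (Suc k)
  have "transpose (matrix_power A (Suc k)) = matrix_power (transpose A) k ** transpose A"
    by (simp add: matrix_transpose_mul Suc)
  then show ?case
    by (simp only: matrix_power_Suc2)
qed (simp add: transpose_mat)

text \<open>Reduces the matrix series to scalar series, so that identities for
  \<open>matrix_exp\<close> can be proved entrywise by uniqueness of sums.\<close>

lemma matrix_exp_nth:
  "(\<lambda>k. (1 / fact k) *\<^sub>R (matrix_power A k $ i $ j)) sums (matrix_exp A $ i $ j)"
proof -
  have "(\<lambda>k. (1 / fact k) *\<^sub>R matrix_power A k) sums matrix_exp A"
    unfolding matrix_exp_def by (rule summable_sums) (rule summable_matrix_exp)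
  from bounded_linear.sums[OF bounded_linear_vec_nth bounded_linear.sums[OF bounded_linear_vec_nth this]]
  show ?thesis
    by simp
qed

lemma transpose_matrix_exp: "transpose (matrix_exp A) = matrix_exp (transpose A)"
proof -
  have "transpose (matrix_exp A) $ i $ j = matrix_exp (transpose A) $ i $ j" for i j
  proof (rule sums_unique2)
    show "(\<lambda>k. (1 / fact k) *\<^sub>R (matrix_power A k $ j $ i)) sums (transpose (matrix_exp A) $ i $ j)"
      using matrix_exp_nth[of A j i] by (simp add: transpose_def)
    show "(\<lambda>k. (1 / fact k) *\<^sub>R (matrix_power A k $ j $ i)) sums (matrix_exp (transpose A) $ i $ j)"
      using matrix_exp_nth[of "transpose A" i j]
      \<comment> \<open>Two passes: the transpose is first pulled out of the power, and only then
        unfolded.\<close>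
      by (simp add: transpose_matrix_power[symmetric]) (simp add: transpose_def)
  qed
  then show ?thesis
    by (simp add: vec_eq_iff)
qed

lemma matrix_power_eigenvector:
  fixes A :: "'a::comm_semiring_1^'n^'n"
  assumes "A *v v = c *s v"
  shows "matrix_power A k *v v = c ^ k *s v"
proof (induction k)
  case (Suc k)
  have "matrix_power A (Suc k) *v v = A *v (c ^ k *s v)"
    by (simp add: matrix_vector_mul_assoc[symmetric] Suc)
  also have "\<dots> = c ^ k *s (A *v v)"
    by (simp add: vec_eq_iff matrix_vector_mult_def sum_distrib_left mult_ac)
  finally show ?case
    by (simp add: assms mult_ac)
qed simp

text \<open>The k-th power acts on \<open>v\<close> as \<open>c ^ k\<close>, so each entry of the
  product is the scalar exponential series times an entry of \<open>v\<close>.\<close>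

lemma matrix_exp_eigenvector:
  assumes "A *v v = c *s v"
  shows "matrix_exp A *v v = exp c *s v"
proof -
  have "(matrix_exp A *v v) $ i = (exp c *s v) $ i" for i
  proof (rule sums_unique2)
    let ?f = "\<lambda>k. \<Sum>j\<in>UNIV. (1 / fact k) *\<^sub>R (matrix_power A k $ i $ j) * v $ j"
    show "?f sums ((matrix_exp A *v v) $ i)"
      unfolding matrix_vector_mult_def vec_lambda_beta
      by (intro sums_sum sums_mult2 matrix_exp_nth)
    have "?f k = (1 / fact k) *\<^sub>R (c ^ k) * v $ i" for k
    proof -
      have "?f k = (1 / fact k) *\<^sub>R (matrix_power A k *v v) $ i"
        by (simp add: matrix_vector_mult_def scaleR_sum_right)
      then show ?thesis
        by (simp add: matrix_power_eigenvector[OF assms])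
    qed
    moreover have "(\<lambda>k. (1 / fact k) *\<^sub>R (c ^ k)) sums exp c"
      using exp_converges[of c] by (simp add: inverse_eq_divide)
    ultimately show "?f sums ((exp c *s v) $ i)"
      by (simp only: sums_mult2 vector_smult_component)
  qed
  then show ?thesis
    by (simp add: vec_eq_iff)
qed

text \<open>The classical argument: the Hermitian form of \<open>M\<close> at \<open>v\<close> is
  real and equals \<open>c\<close> times the squared norm of \<open>v\<close>, which is
  nonzero.\<close>

lemma symmetric_real_matrix_eigenvalue:
  fixes M :: "real^'n^'n"
  assumes "transpose M = M" "v \<noteq> 0" and ev: "map_matrix complex_of_real M *v v = c *s v"
  shows "c \<in> \<real>"
proof -
  have sym: "M $ i $ j = M $ j $ i" for i j
    using assms(1) by (metis transpose_def vec_lambda_beta)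
  have Mv: "(\<Sum>j\<in>UNIV. of_real (M $ i $ j) * v $ j) = c * v $ i" for i
    using ev by (simp add: vec_eq_iff matrix_vector_mult_def map_matrix_def)
  define S where "S = (\<Sum>i\<in>UNIV. (norm (v $ i))\<^sup>2)"
  define T where "T = (\<Sum>i\<in>UNIV. \<Sum>j\<in>UNIV. cnj (v $ i) * (of_real (M $ i $ j) * v $ j))"
  obtain k where "v $ k \<noteq> 0"
    using \<open>v \<noteq> 0\<close> by (auto simp: vec_eq_iff)
  then have "S \<noteq> 0"
    by (auto simp: S_def sum_nonneg_eq_0_iff)
  have "T = (\<Sum>i\<in>UNIV. cnj (v $ i) * (c * v $ i))"
    by (simp add: T_def Mv flip: sum_distrib_left)
  also have "\<dots> = c * of_real S"
    by (simp add: S_def sum_distrib_left complex_norm_square mult_ac del: of_real_power)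
  finally have T: "T = c * of_real S" .
  \<comment> \<open>Since \<open>M\<close> is real and symmetric, conjugation only exchanges the
    roles of \<open>i\<close> and \<open>j\<close>.\<close>
  have "cnj T = (\<Sum>i\<in>UNIV. \<Sum>j\<in>UNIV. cnj (v $ j) * (of_real (M $ j $ i) * v $ i))"
    by (simp add: T_def sym mult_ac)
  also have "\<dots> = T"
    unfolding T_def by (rule sum.swap)
  finally have "cnj c = c"
    using \<open>S \<noteq> 0\<close> by (simp add: T)
  then show ?thesis
    by (simp add: complex_eq_iff complex_is_Real_iff)
qed

lemma transpose_transition_matrix: "transpose (transition_matrix M t) = transition_matrix (transpose M) t"
proof -
  have "transpose (map_matrix f M) = map_matrix f (transpose M)" for f :: "real \<Rightarrow> complex"
    by (simp add: transpose_def map_matrix_def vec_eq_iff)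
  then show ?thesis
    by (simp add: transition_matrix_def transpose_matrix_exp)
qed

lemma transition_matrix_eigenvector:
  assumes "map_matrix complex_of_real M *v v = c *s v"
  shows "transition_matrix M t *v v = exp (\<i> * of_real t * c) *s v"
  unfolding transition_matrix_def
proof (rule matrix_exp_eigenvector)
  have "map_matrix (\<lambda>m. \<i> * complex_of_real (t * m)) M *v v
      = (\<i> * of_real t) *s (map_matrix complex_of_real M *v v)"
    by (simp add: vec_eq_iff matrix_vector_mult_def map_matrix_def sum_distrib_left mult_ac)
  then show "map_matrix (\<lambda>m. \<i> * complex_of_real (t * m)) M *v v = (\<i> * of_real t * c) *s v"
    by (simp add: assms mult.assoc)
qed

text \<open>Applying a matrix to \<open>axis u 1\<close> selects column \<open>u\<close>. Hence
  entry \<open>j\<close> of the vector inside \<open>mixing_error\<close> is the squared modulus of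
  the (j, u) entry minus 1/n, and an entry is bounded by the norm.\<close>

lemma norm_transition_matrix_le_mixing_error:
  fixes M :: "real^'n^'n"
  shows "(norm (transition_matrix M t $ j $ u))\<^sup>2 \<le> 1 / real CARD('n) + mixing_error M t u"
proof -
  let ?z = "transition_matrix M t $ j $ u"
  have "norm (?z * cnj ?z - of_real (1 / real CARD('n))) \<le> mixing_error M t u"
    unfolding mixing_error_def
    by (rule order_trans[OF _ Finite_Cartesian_Product.norm_nth_le[of _ j]])
       (simp add: map_matrix_def scaleR_conv_of_real[where 'a = complex]
         matrix_vector_mult_def axis_def if_distrib cong: if_cong)
  moreover have "?z * cnj ?z - of_real (1 / real CARD('n)) = of_real ((norm ?z)\<^sup>2 - 1 / real CARD('n))"
    by (simp only: of_real_diff complex_norm_square)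
  ultimately have "\<bar>(norm ?z)\<^sup>2 - 1 / real CARD('n)\<bar> \<le> mixing_error M t u"
    by (simp only: norm_of_real)
  then show ?thesis
    by linarith
qed

lemma local_epsilon_uniform_mixing_eigenvector:
  fixes M :: "real^'n^'n"
  assumes sym: "transpose M = M" and mix: "local_epsilon_uniform_mixing M u"
    and "eigenvector M v"
  shows "sqrt (real CARD('n)) * norm (v $ u) \<le> (\<Sum>j\<in>UNIV. norm (v $ j))"
proof -
  define n where "n = real CARD('n)"
  define S where "S = (\<Sum>j\<in>UNIV. norm (v $ j))"
  have "n > 0"
    by (simp add: n_def)
  have "S \<ge> 0"
    by (simp add: S_def sum_nonneg)
  obtain c where "v \<noteq> 0" and c: "map_matrix complex_of_real M *v v = c *s v"
    using \<open>eigenvector M v\<close> by (auto simp: eigenvector_def)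
  then have "c \<in> \<real>"
    using symmetric_real_matrix_eigenvalue[OF sym] by blast
  \<comment> \<open>In squared form the bound is linear in \<open>\<epsilon>\<close>, which makes
    the limit immediate.\<close>
  have bound: "(norm (v $ u))\<^sup>2 \<le> (1 / n + \<epsilon>) * S\<^sup>2" if "\<epsilon> > 0" for \<epsilon>
  proof -
    obtain t where t: "mixing_error M t u < \<epsilon>"
      using mix \<open>\<epsilon> > 0\<close> by (auto simp: local_epsilon_uniform_mixing_def)
    let ?U = "transition_matrix M t"
    \<comment> \<open>Mixing at \<open>u\<close> controls column \<open>u\<close>, whereas entry
      \<open>u\<close> of \<open>?U *v v\<close> involves row \<open>u\<close>.\<close>
    have Usym: "?U $ u $ j = ?U $ j $ u" for j
      using transpose_transition_matrix[of M t] sym by (metis transpose_def vec_lambda_beta)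
    have entry: "norm (?U $ j $ u) \<le> sqrt (1 / n + \<epsilon>)" for j
      using norm_transition_matrix_le_mixing_error[of M t j u] t
      by (intro real_le_rsqrt) (simp add: n_def)
    \<comment> \<open>As \<open>c\<close> is real, the exponent is purely imaginary.\<close>
    have "norm (exp (\<i> * of_real t * c)) = 1"
      using \<open>c \<in> \<real>\<close> by (auto elim!: Reals_cases)
    then have "norm (v $ u) = norm ((?U *v v) $ u)"
      by (simp add: transition_matrix_eigenvector[OF c] norm_mult)
    also have "\<dots> = norm (\<Sum>j\<in>UNIV. ?U $ j $ u * v $ j)"
      by (simp add: matrix_vector_mult_def Usym)
    also have "\<dots> \<le> (\<Sum>j\<in>UNIV. sqrt (1 / n + \<epsilon>) * norm (v $ j))"
      by (rule sum_norm_le) (simp add: norm_mult mult_right_mono entry)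
    also have "\<dots> = sqrt (1 / n + \<epsilon>) * S"
      by (simp add: S_def sum_distrib_left)
    finally have "(norm (v $ u))\<^sup>2 \<le> (sqrt (1 / n + \<epsilon>) * S)\<^sup>2"
      by (simp add: power_mono)
    then show ?thesis
      using \<open>n > 0\<close> \<open>\<epsilon> > 0\<close> by (simp add: power_mult_distrib)
  qed
  \<comment> \<open>The limit is one-sided because \<open>bound\<close> is available for positive
    \<open>\<epsilon>\<close> only.\<close>
  have "((\<lambda>\<epsilon>. (1 / n + \<epsilon>) * S\<^sup>2) \<longlongrightarrow> (1 / n + 0) * S\<^sup>2) (at_right 0)"
    by (intro tendsto_intros)
  moreover have "\<forall>\<^sub>F \<epsilon> in at_right 0. (norm (v $ u))\<^sup>2 \<le> (1 / n + \<epsilon>) * S\<^sup>2"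
    by (rule eventually_mono[OF eventually_at_right_less]) (rule bound)
  ultimately have "(norm (v $ u))\<^sup>2 \<le> (1 / n + 0) * S\<^sup>2"
    by (rule tendsto_lowerbound) simp
  then have "(sqrt n * norm (v $ u))\<^sup>2 \<le> S\<^sup>2"
    using \<open>n > 0\<close> by (simp add: power_mult_distrib field_simps)
  then have "sqrt n * norm (v $ u) \<le> S"
    using \<open>S \<ge> 0\<close> by (rule power2_le_imp_le)
  then show ?thesis
    by (simp add: n_def S_def)
qed

theorem theorem2:
  fixes X :: "'v::finite wgraph" and M :: "real^'v^'v"
  assumes "weighted_graph X"
    and "M \<in> {adjacency_matrix X, laplacian X, signless_laplacian X}"
  shows "(\<forall>u. local_epsilon_uniform_mixing M u \<longrightarrow>
            (\<forall>v. eigenvector M v \<longrightarrow>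
               sqrt (real CARD('v)) * norm (v $ u) \<le> (\<Sum>j\<in>UNIV. norm (v $ j)))) \<and>
         (epsilon_uniform_mixing M \<longrightarrow>
            (\<forall>u v. eigenvector M v \<longrightarrow>
               sqrt (real CARD('v)) * norm (v $ u) \<le> (\<Sum>j\<in>UNIV. norm (v $ j))))"
proof -
  have "transpose M = M"
    using assms(2)
    by (auto simp: laplacian_def signless_laplacian_def transpose_add transpose_diff
        transpose_adjacency_matrix transpose_degree_matrix)
  \<comment> \<open>A time that serves all vertices at once serves each of them.\<close>
  moreover have "local_epsilon_uniform_mixing M u" if "epsilon_uniform_mixing M" for u
    using that unfolding epsilon_uniform_mixing_def local_epsilon_uniform_mixing_def by blast
  ultimately show ?thesis
    using local_epsilon_uniform_mixing_eigenvector by blast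
qed

end
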